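(* Let $n\ge 1$ and let $M\in\mathbb{C}^{n\times n}$ be an invertible matrix such that every row of $M$ is either real or is the entrywise complex conjugate of exactly one other row of $M$. The following two statements are equivalent. (i) For all positive integers $m,p$, every tensor $\mathcal{X}\in\mathbb{R}^{m\times p\times n}$ and every valid multirank $\mathbf{r}=(r_1,\dots,r_n)$ under $\star_M$, $$\|\mathcal{X}-\mathcal{X}_{\mathbf{r}}\|_F^2\le\|\mathcal{X}-\mathcal{Y}\|_F^2\quad\text{for all }\mathcal{Y}\in\mathbb{R}^{m\times p\times n}\text{ such that }\operatorname{rank}(\widehat{\mathcal{Y}}_{:,:,k})\le r_k\text{ for all }k\in\{1,\dots,n\}.$$ (ii) $M$ can be written as $M=DQ$ with $D=\operatorname{diag}(d_1,\dots,d_n)\in\mathbb{R}^{n\times n}$, where $d_1,\dots,d_n$ are nonzero real scalars, and $Q\in\mathbb{C}^{n\times n}$ satisfies $Q^{\mathsf H}Q=I$.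
   Context: Notation: $\mathbb{N}$ includes $0$ here; $A^{\mathsf H}$ is the conjugate transpose; $\|\cdot\|_F$ is the Frobenius norm (square root of the sum of squared moduli of all entries). For an invertible $M\in\mathbb{C}^{n\times n}$ and a tensor $\mathcal{X}\in\mathbb{C}^{m\times p\times n}$ with frontal slices $\mathcal{X}_{:,:,l}\in\mathbb{C}^{m\times p}$, the transform domain image $\widehat{\mathcal{X}}=\mathcal{X}\times_3 M$ is the tensor with frontal slices $\widehat{\mathcal{X}}_{:,:,k}=\sum_{l=1}^n M_{k,l}\,\mathcal{X}_{:,:,l}$. The product $\star_M$ of tensors of compatible sizes is defined by $\widehat{(\mathcal{A}\star_M\mathcal{B})}_{:,:,k}=\widehat{\mathcal{A}}_{:,:,k}\widehat{\mathcal{B}}_{:,:,k}$ for all $k$. (The row condition on $M$ is exactly the condition that $\star_M$ maps pairs of real tubes in $\mathbb{R}^{1\times1\times n}$ to real tubes.) Valid multirank: for $M$ satisfying the row condition, a vector $\mathbf{r}\in\mathbb{N}^n$ is a valid multirank under $\star_M$ if $r_j=r_{j'}$ for all $j,j'\in\{1,\dots,n\}$ such that $M_{j',:}=\overline{M_{j,:}}$. Truncation: for a matrix $A$ and $q\in\mathbb{N}$, $[A]_q$ is the truncation of an SVD of $A$ (singular values in decreasing order) to its top $q$ singular values and corresponding singular vectors ($[A]_q=A$ if $q\ge\operatorname{rank}A$). The multirank-$\mathbf{r}$ truncation $\mathcal{X}_{\mathbf{r}}$ of $\mathcal{X}$ under $\star_M$ is the tensor with $\widehat{(\mathcal{X}_{\mathbf{r}})}_{:,:,k}=[\widehat{\mathcal{X}}_{:,:,k}]_{r_k}$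 for all $k$. When singular values tie, the inequality is understood for any choice of the SVDs. *)

theory Defs
  imports "Jordan_Normal_Form.Schur_Decomposition" "Jordan_Normal_Form.DL_Rank"
begin

text \<open>All indices start from 0. A tensor of size \<open>m \<times> p \<times> n\<close> is given by its frontal slices
  \<open>X 0, \<dots>, X (n - 1)\<close>; the values \<open>X k\<close> for \<open>k \<ge> n\<close> carry no meaning and are never inspected.
  Likewise a multirank in \<open>\<nat>\<^sup>n\<close> is a function on \<open>nat\<close> of which only the first \<open>n\<close> values count.\<close>

type_synonym tensor = "nat \<Rightarrow> complex mat"

definition complex_tensors :: "nat \<Rightarrow> nat \<Rightarrow> nat \<Rightarrow> tensor set" where
  "complex_tensors m p n = {X. \<forall>k<n. X k \<in> carrier_mat m p}"

definition real_tensors :: "nat \<Rightarrow> nat \<Rightarrow> nat \<Rightarrow> tensor set" where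
  "real_tensors m p n =
    {X \<in> complex_tensors m p n. \<forall>k<n. \<forall>i<m. \<forall>j<p. X k $$ (i, j) \<in> \<real>}"

definition tensor_diff :: "tensor \<Rightarrow> tensor \<Rightarrow> tensor" where
  "tensor_diff X Y = (\<lambda>k. X k - Y k)"

definition frobenius_norm :: "nat \<Rightarrow> nat \<Rightarrow> nat \<Rightarrow> tensor \<Rightarrow> real" where
  "frobenius_norm m p n X = sqrt (\<Sum>k<n. \<Sum>i<m. \<Sum>j<p. (cmod (X k $$ (i, j)))\<^sup>2)"

text \<open>The transform domain image \<open>X \<times>\<^sub>3 M\<close>, where \<open>M\<close> is \<open>n \<times> n\<close>. The entrywise formula is used
  because sums over \<open>complex mat\<close> have no zero of unspecified dimension.\<close>

definition transform :: "nat \<Rightarrow> nat \<Rightarrow> complex mat \<Rightarrow> tensor \<Rightarrow> tensor" where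
  "transform m p M X =
    (\<lambda>k. mat m p (\<lambda>(i, j). \<Sum>l<dim_col M. M $$ (k, l) * X l $$ (i, j)))"

definition row_condition :: "nat \<Rightarrow> complex mat \<Rightarrow> bool" where
  "row_condition n M \<longleftrightarrow>
    (\<forall>j<n. (\<forall>l<n. M $$ (j, l) \<in> \<real>)
         \<or> (\<exists>!j'. j' < n \<and> j' \<noteq> j \<and> row M j = conjugate (row M j')))"

definition valid_multirank :: "nat \<Rightarrow> complex mat \<Rightarrow> (nat \<Rightarrow> nat) \<Rightarrow> bool" where
  "valid_multirank n M r \<longleftrightarrow>
    (\<forall>j<n. \<forall>j'<n. row M j' = conjugate (row M j) \<longrightarrow> r j = r j')"

definition is_unitary :: "nat \<Rightarrow> complex mat \<Rightarrow> bool" where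
  "is_unitary n U \<longleftrightarrow> U \<in> carrier_mat n n \<and> mat_adjoint U * U = 1\<^sub>m n"

text \<open>The rectangular \<open>m \<times> p\<close> matrix with diagonal \<open>s 0, s 1, \<dots>\<close>.\<close>

definition rect_diag :: "nat \<Rightarrow> nat \<Rightarrow> (nat \<Rightarrow> real) \<Rightarrow> complex mat" where
  "rect_diag m p s = mat m p (\<lambda>(i, j). if i = j then complex_of_real (s i) else 0)"

definition is_svd ::
  "nat \<Rightarrow> nat \<Rightarrow> complex mat \<Rightarrow> complex mat \<Rightarrow> (nat \<Rightarrow> real) \<Rightarrow> complex mat \<Rightarrow> bool" where
  "is_svd m p A U s V \<longleftrightarrow>
     is_unitary m U \<and> is_unitary p V
   \<and> (\<forall>i<min m p. 0 \<le> s i)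
   \<and> (\<forall>i j. i \<le> j \<and> j < min m p \<longrightarrow> s j \<le> s i)
   \<and> A = U * rect_diag m p s * mat_adjoint V"

text \<open>\<open>B\<close> is obtained from some SVD of \<open>A\<close> by keeping the top \<open>q\<close> singular values and vectors.
  This is a relation because \<open>B\<close> depends on the chosen SVD if singular values tie. For
  \<open>q \<ge> rank A\<close> only zero singular values are dropped, so that \<open>B = A\<close>.\<close>

definition is_truncation :: "nat \<Rightarrow> nat \<Rightarrow> complex mat \<Rightarrow> nat \<Rightarrow> complex mat \<Rightarrow> bool" where
  "is_truncation m p A q B \<longleftrightarrow>
    (\<exists>U s V. is_svd m p A U s V
       \<and> B = U * rect_diag m p (\<lambda>i. if i < q then s i else 0) * mat_adjoint V)"

text \<open>\<open>Z\<close> is a multirank-\<open>r\<close> truncation of \<open>X\<close>. The SVDs of the slices are chosen independently of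
  each other, so if singular values tie then \<open>Z\<close> need not be real even for real \<open>X\<close>.\<close>

definition is_multirank_truncation ::
  "nat \<Rightarrow> nat \<Rightarrow> nat \<Rightarrow> complex mat \<Rightarrow> (nat \<Rightarrow> nat) \<Rightarrow> tensor \<Rightarrow> tensor \<Rightarrow> bool" where
  "is_multirank_truncation m p n M r X Z \<longleftrightarrow>
     Z \<in> complex_tensors m p n
   \<and> (\<forall>k<n. is_truncation m p (transform m p M X k) (r k) (transform m p M Z k))"

end

theory Submission
  imports Defs
begin

text \<open>Write \<open>N = M\<^sup>-\<^sup>1\<close>, with columns \<open>N\<^sub>k\<close>. In the transform domain the squared norm of a tensor is
  the quadratic form with Gram matrix \<open>N\<^sup>H N\<close> in its slices, and \<open>M\<close> is a real diagonal matrix times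
  a unitary one exactly if this Gram matrix is diagonal.

  If it is diagonal, the squared error is a weighted sum of the squared errors of the slices, and
  truncating each slice is best by the Eckart--Young inequality (\<open>eckart_young\<close>). That inequality is
  proved by writing the competitor as \<open>L C\<close> with orthonormal columns in \<open>L\<close>: Pythagoras bounds the
  error below by a sum of squared singular values with weights \<open>1 - w i\<close>, where the \<open>w i\<close> lie in
  \<open>[0, 1]\<close> and sum to the rank, so that at best the largest singular values are removed.

  Conversely, suppose that truncations are optimal. The rows of \<open>M\<close> fall into orbits under complex
  conjugation, and the real and imaginary parts of \<open>N\<^sub>k\<close> are real tubes whose images live on the orbit
  of \<open>k\<close>. If \<open>k\<close> and \<open>l\<close> lie in different orbits, a tube on the first one is truncated to zero by the
  multirank of the second one, and optimality against small multiples of a tube on the second one is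
  orthogonality (\<open>columns_orthogonal_distinct_orbits\<close>). If they form one orbit, orthogonality of \<open>N\<^sub>k\<close>
  and \<open>N\<^sub>l\<close> follows from a tie: a \<open>2 \<times> 2\<close> diagonal slice with entries \<open>a\<close> and \<open>\<i> a\<close> may be truncated to
  either entry, so both errors are equal (\<open>columns_orthogonal_conj_pair\<close>). All columns
  of \<open>N\<close> are thus pairwise orthogonal.\<close>

section \<open>The Frobenius norm and isometries\<close>

lemma mat_adjoint_eq:
  "mat_adjoint (A :: complex mat) = mat (dim_col A) (dim_row A) (\<lambda>(i, j). cnj (A $$ (j, i)))"
  by (rule eq_matI) (auto simp: mat_adjoint_def mat_of_rows_index)

lemma mat_adjoint_dims [simp]:
  "dim_row (mat_adjoint (A :: complex mat)) = dim_col A"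
  "dim_col (mat_adjoint (A :: complex mat)) = dim_row A"
  by (simp_all add: mat_adjoint_eq)

lemma mat_adjoint_carrier [simp]:
  "(A :: complex mat) \<in> carrier_mat m p \<Longrightarrow> mat_adjoint A \<in> carrier_mat p m"
  by (auto simp: mat_adjoint_eq)

lemma adjoint_times_carrier [simp]:
  "(A :: complex mat) \<in> carrier_mat m n \<Longrightarrow> B \<in> carrier_mat m p
    \<Longrightarrow> mat_adjoint A * B \<in> carrier_mat n p"
  by (auto intro!: mult_carrier_mat[of _ n m])

lemma times_adjoint_carrier [simp]:
  "(A :: complex mat) \<in> carrier_mat m n \<Longrightarrow> B \<in> carrier_mat p n
    \<Longrightarrow> A * mat_adjoint B \<in> carrier_mat m p"
  by (auto intro!: mult_carrier_mat[of _ m n])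

lemma mat_adjoint_index:
  "(A :: complex mat) \<in> carrier_mat m p \<Longrightarrow> i < p \<Longrightarrow> j < m
    \<Longrightarrow> mat_adjoint A $$ (i, j) = cnj (A $$ (j, i))"
  by (auto simp: mat_adjoint_eq)

lemma mat_adjoint_mat_adjoint [simp]: "mat_adjoint (mat_adjoint A) = (A :: complex mat)"
  by (rule eq_matI) (auto simp: mat_adjoint_eq)

lemma mat_adjoint_times:
  assumes "(A :: complex mat) \<in> carrier_mat m n" "B \<in> carrier_mat n p"
  shows "mat_adjoint (A * B) = mat_adjoint B * mat_adjoint A"
  using assms
  by (intro eq_matI) (auto simp: mat_adjoint_eq scalar_prod_def ac_simps intro!: sum.cong)

lemma mat_adjoint_minus:
  assumes "(A :: complex mat) \<in> carrier_mat m p" "B \<in> carrier_mat m p"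
  shows "mat_adjoint (A - B) = mat_adjoint A - mat_adjoint B"
  using assms by (intro eq_matI) (auto simp: mat_adjoint_eq)

lemma gram_minus:
  assumes X: "(X :: complex mat) \<in> carrier_mat m p" and Y: "Y \<in> carrier_mat m p"
  shows "mat_adjoint (X - Y) * (X - Y)
    = (mat_adjoint X * X - mat_adjoint X * Y) - (mat_adjoint Y * X - mat_adjoint Y * Y)"
proof -
  have c: "mat_adjoint X \<in> carrier_mat p m" "mat_adjoint Y \<in> carrier_mat p m" using X Y by auto
  show ?thesis
    unfolding mat_adjoint_minus[OF X Y]
    by (simp only: minus_mult_distrib_mat[OF c minus_carrier_mat[OF Y]]
        mult_minus_distrib_mat[OF c(1) X Y] mult_minus_distrib_mat[OF c(2) X Y])
qed

lemma times_index:
  assumes "(A :: complex mat) \<in> carrier_mat m n" "B \<in> carrier_mat n p" "i < m" "j < p"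
  shows "(A * B) $$ (i, j) = (\<Sum>l<n. A $$ (i, l) * B $$ (l, j))"
  using assms by (simp add: scalar_prod_def lessThan_atLeast0)

definition frob_sq :: "complex mat \<Rightarrow> real" where
  "frob_sq A = (\<Sum>i<dim_row A. \<Sum>j<dim_col A. (cmod (A $$ (i, j)))\<^sup>2)"

lemma frob_sq_carrier:
  "A \<in> carrier_mat m p \<Longrightarrow> frob_sq A = (\<Sum>i<m. \<Sum>j<p. (cmod (A $$ (i, j)))\<^sup>2)"
  by (auto simp: frob_sq_def)

lemma frob_sq_nonneg: "0 \<le> frob_sq A"
  by (auto simp: frob_sq_def intro!: sum_nonneg)

lemma frob_sq_adjoint:
  assumes "A \<in> carrier_mat m p" shows "frob_sq (mat_adjoint A) = frob_sq A"
proof -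
  have "frob_sq (mat_adjoint A) = (\<Sum>i<p. \<Sum>j<m. (cmod (A $$ (j, i)))\<^sup>2)"
    using assms by (simp add: frob_sq_def mat_adjoint_eq)
  also have "\<dots> = frob_sq A"
    by (subst sum.swap) (simp add: frob_sq_carrier[OF assms])
  finally show ?thesis .
qed

text \<open>The Frobenius norm depends only on the Gram matrix \<open>A\<^sup>H A\<close>. Isometries on the left leave
  that matrix unchanged, and it expands like a product when \<open>A\<close> is a difference, so the norm
  identities below reduce to matrix algebra.\<close>

lemma frob_sq_eq_trace_gram:
  assumes "A \<in> carrier_mat m p"
  shows "frob_sq A = (\<Sum>j<p. Re ((mat_adjoint A * A) $$ (j, j)))"
proof -
  have "Re (cnj z * z) = (cmod z)\<^sup>2" for z
    unfolding cmod_power2 by (simp add: power2_eq_square)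
  then have "Re ((mat_adjoint A * A) $$ (j, j)) = (\<Sum>i<m. (cmod (A $$ (i, j)))\<^sup>2)"
    if "j < p" for j
    using assms that
    by (simp add: times_index[of _ p m _ p] mat_adjoint_index del: index_mult_mat complex_cnj_mult
        times_complex.sel)
  then show ?thesis
    by (simp add: frob_sq_carrier[OF assms] sum.swap[of _ "{..<m}"])
qed

lemma frob_sq_isometry_left:
  assumes U: "U \<in> carrier_mat m n" and UU: "mat_adjoint U * U = 1\<^sub>m n"
    and A: "A \<in> carrier_mat n p"
  shows "frob_sq (U * A) = frob_sq A"
proof -
  have "mat_adjoint (U * A) * (U * A) = mat_adjoint A * (mat_adjoint U * (U * A))"
    using U A by (subst mat_adjoint_times[OF U A], subst assoc_mult_mat[of _ p n _ m _ p]) auto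
  also have "mat_adjoint U * (U * A) = A"
    using U A by (subst assoc_mult_mat[symmetric, of _ n m _ n _ p]) (auto simp: UU)
  finally show ?thesis
    using U A by (simp add: frob_sq_eq_trace_gram[of _ m p] frob_sq_eq_trace_gram[of _ n p])
qed

lemma frob_sq_isometry_right:
  assumes V: "V \<in> carrier_mat m n" and VV: "mat_adjoint V * V = 1\<^sub>m n"
    and A: "A \<in> carrier_mat p n"
  shows "frob_sq (A * mat_adjoint V) = frob_sq A"
proof -
  have "frob_sq (A * mat_adjoint V) = frob_sq (V * mat_adjoint A)"
    using frob_sq_adjoint[of "V * mat_adjoint A" m p] A V
    by (simp add: mat_adjoint_times[of _ m n _ p])
  then show ?thesis
    using frob_sq_isometry_left[OF V VV, of "mat_adjoint A" p] A by (simp add: frob_sq_adjoint)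
qed

text \<open>Pythagoras: the columns of \<open>S - L L\<^sup>H S\<close> are orthogonal to the range of \<open>L\<close>, and \<open>L L\<^sup>H S - L C\<close>
  lies in that range. The first part has squared norm \<open>\<parallel>S\<parallel>\<^sup>2 - \<parallel>L\<^sup>H S\<parallel>\<^sup>2\<close>, which is therefore the
  distance from \<open>S\<close> to the matrices with columns in the range of \<open>L\<close>.\<close>

lemma frob_sq_minus_range:
  assumes L: "L \<in> carrier_mat m r" and LL: "mat_adjoint L * L = 1\<^sub>m r"
    and S: "S \<in> carrier_mat m p" and C: "C \<in> carrier_mat r p"
  shows "frob_sq (S - L * C)
    = frob_sq S - frob_sq (mat_adjoint L * S) + frob_sq (mat_adjoint L * S - C)"
proof -
  define T where "T = mat_adjoint L * S"
  have T: "T \<in> carrier_mat r p" using L S by (auto simp: T_def)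
  have TC: "T - C \<in> carrier_mat r p" using T C by auto
  have c: "mat_adjoint L \<in> carrier_mat r m" "mat_adjoint S \<in> carrier_mat p m"
    "mat_adjoint C \<in> carrier_mat p r" "mat_adjoint T \<in> carrier_mat p r" "L * C \<in> carrier_mat m p"
    using L S C T by auto
  have adjT: "mat_adjoint T = mat_adjoint S * L"
    using c(1) S by (simp add: T_def mat_adjoint_times[of _ r m _ p])
  have adjLC: "mat_adjoint (L * C) = mat_adjoint C * mat_adjoint L"
    using L C by (rule mat_adjoint_times)
  have LLC: "mat_adjoint L * (L * C) = C"
    using c L C by (subst assoc_mult_mat[symmetric, of _ r m _ r _ p]) (auto simp: LL)
  have SLC: "mat_adjoint S * (L * C) = mat_adjoint T * C"
    unfolding adjT using c L C by (intro assoc_mult_mat[symmetric]) auto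
  have CLS: "mat_adjoint (L * C) * S = mat_adjoint C * T"
    unfolding adjLC T_def using c L S by (intro assoc_mult_mat) auto
  have CLLC: "mat_adjoint (L * C) * (L * C) = mat_adjoint C * C"
    unfolding adjLC using c L C LLC by (subst assoc_mult_mat[of _ p r _ m _ p]) auto
  have "mat_adjoint (S - L * C) * (S - L * C)
      = (mat_adjoint S * S - mat_adjoint T * C) - (mat_adjoint C * T - mat_adjoint C * C)"
    unfolding gram_minus[OF S c(5)] SLC CLS CLLC ..
  moreover have "mat_adjoint (T - C) * (T - C)
      = (mat_adjoint T * T - mat_adjoint T * C) - (mat_adjoint C * T - mat_adjoint C * C)"
    by (rule gram_minus[OF T C])
  ultimately have "Re ((mat_adjoint (S - L * C) * (S - L * C)) $$ (j, j))
      = Re ((mat_adjoint S * S) $$ (j, j)) - Re ((mat_adjoint T * T) $$ (j, j))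
        + Re ((mat_adjoint (T - C) * (T - C)) $$ (j, j))" if "j < p" for j
    using that c S T C by (simp del: index_mult_mat(1))
  then have "frob_sq (S - L * C) = frob_sq S - frob_sq T + frob_sq (T - C)"
    unfolding frob_sq_eq_trace_gram[OF minus_carrier_mat[OF c(5)]] frob_sq_eq_trace_gram[OF S]
      frob_sq_eq_trace_gram[OF T] frob_sq_eq_trace_gram[OF TC]
    by (simp add: sum_subtractf sum.distrib del: index_mult_mat(1))
  then show ?thesis by (simp add: T_def)
qed

lemma frob_sq_adjoint_times_rect_diag:
  assumes L: "L \<in> carrier_mat m r"
  shows "frob_sq (mat_adjoint L * rect_diag m p s)
    = (\<Sum>j<min m p. (s j)\<^sup>2 * (\<Sum>t<r. (cmod (L $$ (j, t)))\<^sup>2))"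
proof -
  have R: "rect_diag m p s \<in> carrier_mat m p" by (simp add: rect_diag_def)
  have "(mat_adjoint L * rect_diag m p s) $$ (t, j)
      = (if j < m then cnj (L $$ (j, t)) * s j else 0)" if "t < r" "j < p" for t j
    using that L
    by (subst times_index[of _ r m _ p])
      (auto simp: R mat_adjoint_index rect_diag_def if_distrib[of "(*) _"] sum.delta cong: if_cong)
  then have "frob_sq (mat_adjoint L * rect_diag m p s)
      = (\<Sum>t<r. \<Sum>j<p. if j < m then (s j)\<^sup>2 * (cmod (L $$ (j, t)))\<^sup>2 else 0)"
    using L R by (subst frob_sq_carrier[of _ r p])
      (auto simp del: index_mult_mat(1) simp: norm_mult power_mult_distrib intro!: sum.cong)
  also have "\<dots> = (\<Sum>j<p. \<Sum>t<r. if j < m then (s j)\<^sup>2 * (cmod (L $$ (j, t)))\<^sup>2 else 0)"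
    by (rule sum.swap)
  also have "\<dots> = (\<Sum>j<min m p. \<Sum>t<r. if j < m then (s j)\<^sup>2 * (cmod (L $$ (j, t)))\<^sup>2 else 0)"
    by (rule sum.mono_neutral_right) auto
  finally show ?thesis by (simp add: sum_distrib_left)
qed

lemma frob_sq_rect_diag: "frob_sq (rect_diag m p s) = (\<Sum>j<min m p. (s j)\<^sup>2)"
proof -
  have "frob_sq (rect_diag m p s) = (\<Sum>i<m. if i < p then (s i)\<^sup>2 else 0)"
    by (auto simp: frob_sq_def rect_diag_def if_distrib[of cmod] if_distrib[of "\<lambda>x. x\<^sup>2"]
        sum.delta intro!: sum.cong cong: if_cong)
  also have "\<dots> = (\<Sum>j<min m p. if j < p then (s j)\<^sup>2 else 0)"
    by (rule sum.mono_neutral_right) auto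
  finally show ?thesis by simp
qed

text \<open>Bessel's inequality for the \<open>j\<close>-th unit vector, obtained from Pythagoras by approximating the
  matrix whose only nonzero entry is a \<open>1\<close> at \<open>(j, j)\<close>.\<close>

lemma isometry_row_le_1:
  assumes L: "L \<in> carrier_mat m r" and LL: "mat_adjoint L * L = 1\<^sub>m r" and j: "j < m"
  shows "(\<Sum>t<r. (cmod (L $$ (j, t)))\<^sup>2) \<le> 1"
proof -
  define E where "E = rect_diag m m (\<lambda>i. if i = j then 1 else 0)"
  have E: "E \<in> carrier_mat m m" by (simp add: E_def rect_diag_def)
  have "frob_sq E = 1"
    using j by (simp add: E_def frob_sq_rect_diag if_distrib[of "\<lambda>x. x\<^sup>2"] sum.delta cong: if_cong)
  moreover have "frob_sq (mat_adjoint L * E) = (\<Sum>t<r. (cmod (L $$ (j, t)))\<^sup>2)"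
    using j by (simp add: E_def frob_sq_adjoint_times_rect_diag[OF L] if_distrib[of "\<lambda>x. x\<^sup>2"]
        if_distrib[of "\<lambda>x. x * _"] sum.delta cong: if_cong)
  moreover have "mat_adjoint L * E \<in> carrier_mat r m"
    using L E by auto
  then have "frob_sq (mat_adjoint L * E) \<le> frob_sq E"
    using frob_sq_minus_range[OF L LL E, of "mat_adjoint L * E"]
      frob_sq_nonneg[of "E - L * (mat_adjoint L * E)"]
    by (simp add: frob_sq_def[of "0\<^sub>m _ _"])
  ultimately show ?thesis by simp
qed


lemma frob_sq_isometry:
  assumes L: "L \<in> carrier_mat m r" and LL: "mat_adjoint L * L = 1\<^sub>m r"
  shows "frob_sq L = real r"
  by (subst frob_sq_eq_trace_gram[OF L]) (simp add: LL)

section \<open>The Eckart--Young inequality\<close>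

text \<open>Removing total weight at most \<open>q\<close>, and at most \<open>1\<close> from each term, from a decreasing sequence
  takes away no more than its first \<open>q\<close> terms: relative to the threshold \<open>s q\<close>, weight inside the
  first \<open>q\<close> positions is worth at least, and weight outside at most, \<open>(s q)\<^sup>2\<close> per unit.\<close>

lemma sorted_weighted_tail_le:
  fixes s w :: "nat \<Rightarrow> real"
  assumes nonneg: "\<And>i. i < k \<Longrightarrow> 0 \<le> s i"
    and sorted: "\<And>i j. i \<le> j \<Longrightarrow> j < k \<Longrightarrow> s j \<le> s i"
    and w: "\<And>i. i < k \<Longrightarrow> 0 \<le> w i" "\<And>i. i < k \<Longrightarrow> w i \<le> 1"
    and sum_w: "(\<Sum>i<k. w i) \<le> real q"
  shows "(\<Sum>i<k. if i < q then 0 else (s i)\<^sup>2) \<le> (\<Sum>i<k. (s i)\<^sup>2 * (1 - w i))"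
proof (cases "q < k")
  case False
  then have "(\<Sum>i<k. if i < q then 0 else (s i)\<^sup>2) = 0" by (intro sum.neutral) auto
  also have "\<dots> \<le> (\<Sum>i<k. (s i)\<^sup>2 * (1 - w i))" using w by (intro sum_nonneg) auto
  finally show ?thesis .
next
  case True
  have *: "(s q)\<^sup>2 * ((if i < q then 1 else 0) - w i)
      \<le> (s i)\<^sup>2 * (1 - w i) - (if i < q then 0 else (s i)\<^sup>2)" if i: "i < k" for i
  proof (cases "i < q")
    case True
    then have "(s q)\<^sup>2 \<le> (s i)\<^sup>2" using sorted[of i q] nonneg \<open>q < k\<close> by (intro power_mono) auto
    then show ?thesis using w[OF i] True by (auto intro!: mult_right_mono)
  next
    case False
    then have "(s i)\<^sup>2 \<le> (s q)\<^sup>2" using sorted[of q i] nonneg i by (intro power_mono) auto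
    then show ?thesis using w[OF i] False by (auto simp: algebra_simps intro!: mult_left_mono)
  qed
  have "(\<Sum>i<k. (if i < q then 1 else 0::real)) = (\<Sum>i<q. 1)"
    using True by (intro sum.mono_neutral_cong_right) auto
  then have "0 \<le> (s q)\<^sup>2 * ((\<Sum>i<k. (if i < q then 1 else 0)) - (\<Sum>i<k. w i))"
    using sum_w by simp
  also have "\<dots> = (\<Sum>i<k. (s q)\<^sup>2 * ((if i < q then 1 else 0) - w i))"
    by (simp add: sum_distrib_left sum_subtractf right_diff_distrib)
  also have "\<dots> \<le> (\<Sum>i<k. (s i)\<^sup>2 * (1 - w i) - (if i < q then 0 else (s i)\<^sup>2))"
    using * by (intro sum_mono) auto
  finally show ?thesis by (simp only: sum_subtractf)
qed

text \<open>The \<open>i\<close>-th squared singular value survives the best approximation with columns in the range of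
  \<open>L\<close> with factor \<open>1 - w i\<close>, where \<open>w i\<close> is the squared norm of the \<open>i\<close>-th row of \<open>L\<close>. These
  weights are at most \<open>1\<close> and sum to the number of columns of \<open>L\<close>.\<close>

lemma eckart_young_diag:
  assumes L: "L \<in> carrier_mat m r" and LL: "mat_adjoint L * L = 1\<^sub>m r" and "r \<le> q"
    and C: "C \<in> carrier_mat r p"
    and nonneg: "\<And>i. i < min m p \<Longrightarrow> 0 \<le> s i"
    and sorted: "\<And>i j. i \<le> j \<Longrightarrow> j < min m p \<Longrightarrow> s j \<le> s i"
  shows "(\<Sum>i<min m p. if i < q then 0 else (s i)\<^sup>2) \<le> frob_sq (rect_diag m p s - L * C)"
proof -
  define w where "w j = (\<Sum>t<r. (cmod (L $$ (j, t)))\<^sup>2)" for j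
  have R: "rect_diag m p s \<in> carrier_mat m p" by (simp add: rect_diag_def)
  have "(\<Sum>j<min m p. w j) \<le> (\<Sum>j<m. w j)"
    by (intro sum_mono2) (auto simp: w_def intro!: sum_nonneg)
  also have "\<dots> = r"
    using frob_sq_isometry[OF L LL] by (simp add: w_def frob_sq_carrier[OF L])
  finally have sum_w: "(\<Sum>j<min m p. w j) \<le> q" using \<open>r \<le> q\<close> by simp
  have "(\<Sum>i<min m p. if i < q then 0 else (s i)\<^sup>2) \<le> (\<Sum>i<min m p. (s i)\<^sup>2 * (1 - w i))"
    using isometry_row_le_1[OF L LL] sum_w nonneg sorted
    by (intro sorted_weighted_tail_le) (auto simp: w_def intro!: sum_nonneg)
  also have "\<dots> = frob_sq (rect_diag m p s) - frob_sq (mat_adjoint L * rect_diag m p s)"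
    by (simp add: frob_sq_rect_diag frob_sq_adjoint_times_rect_diag[OF L] w_def
        right_diff_distrib sum_subtractf)
  also have "\<dots> \<le> frob_sq (rect_diag m p s - L * C)"
    using frob_sq_minus_range[OF L LL R C] frob_sq_nonneg by simp
  finally show ?thesis .
qed

text \<open>A maximal independent set of columns spans the column space. It is delivered as a list because
  the Gram--Schmidt process works on lists.\<close>

lemma (in vec_space) rank_spanning_list:
  assumes B: "B \<in> carrier_mat n p"
  obtains us where "set us \<subseteq> carrier_vec n" "distinct us" "lin_indpt (set us)"
    "length us = rank B" "set (cols B) \<subseteq> span (set us)"
proof -
  let ?P = "\<lambda>T. T \<subseteq> set (cols B) \<and> lin_indpt T"
  have carr: "set (cols B) \<subseteq> carrier_vec n" using B cols_dim by blast
  have "?P {}" by (simp add: lin_dep_def)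
  then obtain U where U: "maximal U ?P" "finite U"
    using maximal_exists_superset[of "set (cols B)" ?P "{}"] by auto
  then have "U \<subseteq> set (cols B)" and ind: "lin_indpt U" by (auto simp: maximal_def)
  then have Uc: "U \<subseteq> carrier_vec n" using carr by auto
  have "s \<in> span U" if s: "s \<in> set (cols B)" for s
  proof (rule ccontr)
    assume ns: "s \<notin> span U"
    then have "s \<notin> U" using span_mem[OF Uc] by auto
    have "lin_indpt (insert s U)"
      using lin_dep_iff_in_span[OF Uc ind _ \<open>s \<notin> U\<close>] s carr ns by auto
    then have "?P (insert s U)" using s \<open>U \<subseteq> set (cols B)\<close> by auto
    then have "insert s U = U" using U(1) unfolding maximal_def by blast
    with \<open>s \<notin> U\<close> show False by auto
  qed
  moreover obtain us where "set us = U" "distinct us" using finite_distinct_list[OF U(2)] by auto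
  ultimately show ?thesis
    using that[of us] Uc ind rank_card_indpt[OF B U(1)] by (metis distinct_card subsetI)
qed

text \<open>The rank enters the Eckart--Young inequality only through this factorisation: the columns of \<open>L\<close>
  are an orthonormal basis of the column space, from the Gram--Schmidt process followed by
  normalisation.\<close>

lemma orthonormal_column_space_factor:
  assumes B: "(B :: complex mat) \<in> carrier_mat m p"
  obtains L C where "L \<in> carrier_mat m (vec_space.rank m B)"
    "mat_adjoint L * L = 1\<^sub>m (vec_space.rank m B)"
    "C \<in> carrier_mat (vec_space.rank m B) p" "B = L * C"
proof -
  interpret cof_vec_space m "TYPE(complex)" .
  obtain us where us: "set us \<subseteq> carrier_vec m" "distinct us" "lin_indpt (set us)"
    "length us = rank B" "set (cols B) \<subseteq> span (set us)"
    using rank_spanning_list[OF B] by metis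
  define ws where "ws = gram_schmidt m us"
  define r where "r = rank B"
  note gs = gram_schmidt_result[OF us(1-3) ws_def]
  have len: "length ws = r" using gs(4) us(4) by (simp add: r_def)
  have wc: "ws ! t \<in> carrier_vec m" if "t < r" for t using gs(3) that len by auto
  define h where "h t = sqrt (\<Sum>i<m. (cmod (ws ! t $ i))\<^sup>2)" for t
  have sp: "(ws ! t) \<bullet>c (ws ! t') = (\<Sum>i<m. ws ! t $ i * cnj (ws ! t' $ i))" if "t < r" "t' < r" for t t'
    using wc[of t] wc[of t'] that by (auto simp: scalar_prod_def lessThan_atLeast0)
  have hh: "complex_of_real (h t) * h t = (ws ! t) \<bullet>c (ws ! t)" if "t < r" for t
  proof -
    have "complex_of_real (h t) * h t = complex_of_real (\<Sum>i<m. (cmod (ws ! t $ i))\<^sup>2)"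
      by (simp add: h_def sum_nonneg flip: of_real_mult)
    then show ?thesis unfolding sp[OF that that] by (simp only: of_real_sum complex_norm_square)
  qed
  have h0: "h t \<noteq> 0" if "t < r" for t
    using hh[OF that] corthogonalD[OF gs(2), of t t] that len by auto
  define L where "L = mat m r (\<lambda>(i, t). ws ! t $ i / h t)"
  have L: "L \<in> carrier_mat m r" by (simp add: L_def)
  have L_index: "L $$ (i, t) = ws ! t $ i / h t" if "i < m" "t < r" for i t
    using that by (simp add: L_def)
  have "mat_adjoint L * L = 1\<^sub>m r"
  proof (rule eq_matI)
    fix t t' assume "t < dim_row (1\<^sub>m r :: complex mat)" "t' < dim_col (1\<^sub>m r :: complex mat)"
    then have t: "t < r" "t' < r" by auto
    have "(mat_adjoint L * L) $$ (t, t')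
        = (\<Sum>i<m. cnj (ws ! t $ i / h t) * (ws ! t' $ i / h t'))"
      using t L by (simp add: times_index[of _ r m _ r] mat_adjoint_index[OF L] L_index
          del: index_mult_mat)
    also have "\<dots> = ((ws ! t') \<bullet>c (ws ! t)) / (h t * h t')"
      using t by (simp add: sp sum_divide_distrib ac_simps)
    also have "\<dots> = 1\<^sub>m r $$ (t, t')"
    proof (cases "t = t'")
      case True then show ?thesis using t h0[of t] by (simp flip: hh)
    next
      case False then show ?thesis using t corthogonalD[OF gs(2), of t' t] len by auto
    qed
    finally show "(mat_adjoint L * L) $$ (t, t') = 1\<^sub>m r $$ (t, t')" .
  qed (use L in auto)
  moreover have "\<exists>a. \<forall>i<m. B $$ (i, j) = (\<Sum>t<r. L $$ (i, t) * a t)" if j: "j < p" for j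
  proof -
    have "col B j \<in> span (set ws)"
      using us(5) gs(1) j B by (metis carrier_matD(2) cols_length cols_nth nth_mem subsetD)
    from finite_in_span[OF List.finite_set gs(3) this]
    obtain f where "lincomb f (set ws) = col B j" by auto
    moreover have "lincomb f (set ws) = mat_of_cols m ws *\<^sub>v vec r (\<lambda>t. f (ws ! t))"
      unfolding lincomb_as_lincomb_list_distinct[OF gs(3,5)] len[symmetric]
      using gs(3) by (intro lincomb_list_as_mat_mult) auto
    ultimately have "B $$ (i, j) = (mat_of_cols m ws *\<^sub>v vec r (\<lambda>t. f (ws ! t))) $ i" if "i < m" for i
      using that j B by simp
    moreover have "(mat_of_cols m ws *\<^sub>v vec r (\<lambda>t. f (ws ! t))) $ i
        = (\<Sum>t<r. L $$ (i, t) * (h t * f (ws ! t)))" if "i < m" for i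
    proof -
      have "(mat_of_cols m ws *\<^sub>v vec r (\<lambda>t. f (ws ! t))) $ i = (\<Sum>t<r. ws ! t $ i * f (ws ! t))"
        using that len by (simp add: scalar_prod_def lessThan_atLeast0 mat_of_cols_index)
      also have "\<dots> = (\<Sum>t<r. L $$ (i, t) * (h t * f (ws ! t)))"
        using that h0 by (intro sum.cong) (auto simp: L_index)
      finally show ?thesis .
    qed
    ultimately have "\<forall>i<m. B $$ (i, j) = (\<Sum>t<r. L $$ (i, t) * (h t * f (ws ! t)))"
      by simp
    then show ?thesis by (rule exI[of _ "\<lambda>t. h t * f (ws ! t)"])
  qed
  then obtain a where a: "\<And>i j. i < m \<Longrightarrow> j < p \<Longrightarrow> B $$ (i, j) = (\<Sum>t<r. L $$ (i, t) * a j t)"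
    by metis
  define C where "C = mat r p (\<lambda>(t, j). a j t)"
  have C: "C \<in> carrier_mat r p" and C_index: "\<And>t j. t < r \<Longrightarrow> j < p \<Longrightarrow> C $$ (t, j) = a j t"
    by (auto simp: C_def)
  have "B = L * C"
  proof (rule eq_matI)
    fix i j assume "i < dim_row (L * C)" "j < dim_col (L * C)"
    then have ij: "i < m" "j < p" using L C by auto
    show "B $$ (i, j) = (L * C) $$ (i, j)"
      unfolding times_index[OF L C ij] a[OF ij] using ij by (intro sum.cong) (auto simp: C_index)
  qed (use B L C in auto)
  ultimately show ?thesis using that[OF _ _ C[unfolded r_def]] L unfolding r_def by blast
qed

text \<open>Unitary factors do not change the norm, so \<open>A - B\<close> may be replaced by \<open>\<Sigma> - U\<^sup>H B V\<close>, and
  \<open>U\<^sup>H B V = (U\<^sup>H L) (C V)\<close> again has an isometry as its left factor when \<open>B = L C\<close> does. The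
  diagonal case applies whichever SVD the truncation was formed from.\<close>

theorem eckart_young:
  assumes A: "A \<in> carrier_mat m p" and trunc: "is_truncation m p A q A'"
    and B: "B \<in> carrier_mat m p" and rank: "vec_space.rank m B \<le> q"
  shows "frob_sq (A - A') \<le> frob_sq (A - B)"
proof -
  obtain U s V where svd: "is_svd m p A U s V"
    and A': "A' = U * rect_diag m p (\<lambda>i. if i < q then s i else 0) * mat_adjoint V"
    using trunc by (auto simp: is_truncation_def)
  let ?S = "rect_diag m p s" and ?S' = "rect_diag m p (\<lambda>i. if i < q then s i else 0)"
  have U: "U \<in> carrier_mat m m" "mat_adjoint U * U = 1\<^sub>m m"
    and V: "V \<in> carrier_mat p p" "mat_adjoint V * V = 1\<^sub>m p"
    and AS: "A = U * ?S * mat_adjoint V"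
    using svd by (auto simp: is_svd_def is_unitary_def)
  have VV: "V * mat_adjoint V = 1\<^sub>m p"
    using mat_mult_left_right_inverse[OF _ V(1) V(2)] V(1) by simp
  have UU: "U * mat_adjoint U = 1\<^sub>m m"
    using mat_mult_left_right_inverse[OF _ U(1) U(2)] U(1) by simp
  have R: "?S \<in> carrier_mat m p" "?S' \<in> carrier_mat m p" by (auto simp: rect_diag_def)
  have unitary: "frob_sq (U * X * mat_adjoint V - U * Y * mat_adjoint V) = frob_sq (X - Y)"
    if XY: "X \<in> carrier_mat m p" "Y \<in> carrier_mat m p" for X Y
  proof -
    have "U * X * mat_adjoint V - U * Y * mat_adjoint V = U * (X - Y) * mat_adjoint V"
      using U V XY by (subst mult_minus_distrib_mat[of _ m m _ p], simp, simp, simp,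
          subst minus_mult_distrib_mat[of _ m p _ _ p]) auto
    then show ?thesis
      using U V XY frob_sq_isometry_right[OF V, of "U * (X - Y)" m]
        frob_sq_isometry_left[OF U, of "X - Y" p] by (metis minus_carrier_mat mult_carrier_mat)
  qed
  obtain L C where L: "L \<in> carrier_mat m (vec_space.rank m B)"
      "mat_adjoint L * L = 1\<^sub>m (vec_space.rank m B)"
    and C: "C \<in> carrier_mat (vec_space.rank m B) p" and BLC: "B = L * C"
    using orthonormal_column_space_factor[OF B] by metis
  define r where "r = vec_space.rank m B"
  note L = L[folded r_def] and C = C[folded r_def]
  define L' C' where "L' = mat_adjoint U * L" and "C' = C * V"
  have L'c: "L' \<in> carrier_mat m r" and C'c: "C' \<in> carrier_mat r p"
    using U L V C by (auto simp: L'_def C'_def)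
  have "mat_adjoint L' * L' = mat_adjoint L * (U * (mat_adjoint U * L))"
    using U L by (simp add: L'_def mat_adjoint_times[of _ m m _ r] assoc_mult_mat[of _ r m _ m _ r])
  also have "U * (mat_adjoint U * L) = L"
    using U L by (subst assoc_mult_mat[symmetric, of _ m m _ m _ r]) (auto simp: UU)
  finally have L'L': "mat_adjoint L' * L' = 1\<^sub>m r" using L by simp
  have "U * (L' * C') * mat_adjoint V = U * L' * (C' * mat_adjoint V)"
    using U L'c C'c V
    by (subst assoc_mult_mat[symmetric, of _ m m _ r _ p], simp, simp, simp,
        subst assoc_mult_mat[of _ m r _ p _ p]) auto
  also have "U * L' = L"
    unfolding L'_def using U L by (subst assoc_mult_mat[symmetric, of _ m m _ m _ r]) (auto simp: UU)
  also have "C' * mat_adjoint V = C"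
    unfolding C'_def using V C by (subst assoc_mult_mat[of _ r p _ p _ p]) (auto simp: VV)
  finally have B': "B = U * (L' * C') * mat_adjoint V" by (simp add: BLC)
  have "?S - ?S' = rect_diag m p (\<lambda>i. if i < q then 0 else s i)"
    by (rule eq_matI) (auto simp: rect_diag_def)
  then have "frob_sq (A - A') = (\<Sum>i<min m p. (if i < q then 0 else s i)\<^sup>2)"
    using unitary[OF R] by (simp add: AS A' frob_sq_rect_diag)
  also have "\<dots> = (\<Sum>i<min m p. if i < q then 0 else (s i)\<^sup>2)"
    by (intro sum.cong) auto
  also have "\<dots> \<le> frob_sq (?S - L' * C')"
    using svd rank by (intro eckart_young_diag[OF L'c L'L' _ C'c]) (auto simp: is_svd_def r_def)
  also have "\<dots> = frob_sq (A - B)"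
    using unitary[OF R(1), of "L' * C'"] L'c C'c by (simp add: AS B')
  finally show ?thesis .
qed

section \<open>Optimality for scaled unitary transforms\<close>

lemma isometry_sum:
  assumes L: "L \<in> carrier_mat m n" and LL: "mat_adjoint L * L = 1\<^sub>m n"
  shows "(\<Sum>k<m. (cmod (\<Sum>l<n. L $$ (k, l) * x l))\<^sup>2) = (\<Sum>l<n. (cmod (x l))\<^sup>2)"
proof -
  define A where "A = mat n 1 (\<lambda>(l, _). x l)"
  have A: "A \<in> carrier_mat n 1" by (simp add: A_def)
  have A_index: "A $$ (l, 0) = x l" if "l < n" for l using that by (simp add: A_def)
  have "frob_sq (L * A) = (\<Sum>k<m. (cmod (\<Sum>l<n. L $$ (k, l) * x l))\<^sup>2)"
    using times_index[OF L A, of _ 0] L A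
    by (subst frob_sq_carrier[of _ m 1]) (auto simp: A_index simp del: index_mult_mat(1))
  moreover have "frob_sq A = (\<Sum>l<n. (cmod (x l))\<^sup>2)"
    by (simp add: frob_sq_def A_def)
  ultimately show ?thesis using frob_sq_isometry_left[OF L LL A] by simp
qed

lemma frobenius_norm_sq:
  "(frobenius_norm m p n X)\<^sup>2 = (\<Sum>k<n. \<Sum>i<m. \<Sum>j<p. (cmod (X k $$ (i, j)))\<^sup>2)"
  by (simp add: frobenius_norm_def sum_nonneg)

lemma transform_carrier [simp]: "transform m p M X k \<in> carrier_mat m p"
  by (simp add: transform_def)

lemma transform_tensor_diff:
  assumes "X \<in> complex_tensors m p n" "Y \<in> complex_tensors m p n" "dim_col M = n"
  shows "transform m p M (tensor_diff X Y) k = transform m p M X k - transform m p M Y k"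
  using assms
  by (intro eq_matI)
    (auto simp: transform_def tensor_diff_def complex_tensors_def right_diff_distrib
      simp flip: sum_subtractf intro!: sum.cong)

text \<open>Up to the factor \<open>d k\<close>, the \<open>k\<close>-th slice of the image is the \<open>k\<close>-th coordinate of a unitary map
  applied to every tube.\<close>

lemma frobenius_norm_transform:
  assumes Q: "Q \<in> carrier_mat n n" "mat_adjoint Q * Q = 1\<^sub>m n"
    and d: "\<And>k. k < n \<Longrightarrow> d k \<noteq> 0"
    and M: "M = mat_diag n (\<lambda>i. complex_of_real (d i)) * Q"
  shows "(frobenius_norm m p n X)\<^sup>2 = (\<Sum>k<n. frob_sq (transform m p M X k) / (d k)\<^sup>2)"
proof -
  have dimM: "dim_col M = n" using Q by (simp add: M)
  have MQ: "M $$ (k, l) = d k * Q $$ (k, l)" if "k < n" "l < n" for k l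
    using that by (simp add: M mat_diag_mult_left[OF Q(1)])
  have "(cmod (transform m p M X k $$ (i, j)))\<^sup>2 / (d k)\<^sup>2
      = (cmod (\<Sum>l<n. Q $$ (k, l) * X l $$ (i, j)))\<^sup>2" if "k < n" "i < m" "j < p" for i j k
  proof -
    have "transform m p M X k $$ (i, j) = d k * (\<Sum>l<n. Q $$ (k, l) * X l $$ (i, j))"
      using that by (simp add: transform_def dimM MQ sum_distrib_left mult.assoc)
    then show ?thesis using d[OF that(1)] by (simp add: norm_mult power_mult_distrib)
  qed
  then have "(\<Sum>k<n. frob_sq (transform m p M X k) / (d k)\<^sup>2)
      = (\<Sum>k<n. \<Sum>i<m. \<Sum>j<p. (cmod (\<Sum>l<n. Q $$ (k, l) * X l $$ (i, j)))\<^sup>2)"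
    by (simp add: frob_sq_carrier[of _ m p] sum_divide_distrib)
  also have "\<dots> = (\<Sum>i<m. \<Sum>j<p. \<Sum>k<n. (cmod (\<Sum>l<n. Q $$ (k, l) * X l $$ (i, j)))\<^sup>2)"
    by (simp add: sum.swap[of _ "{..<n}"])
  also have "\<dots> = (\<Sum>i<m. \<Sum>j<p. \<Sum>l<n. (cmod (X l $$ (i, j)))\<^sup>2)"
    by (simp add: isometry_sum[OF Q])
  also have "\<dots> = (frobenius_norm m p n X)\<^sup>2"
    by (simp add: frobenius_norm_sq sum.swap[of _ "{..<n}"])
  finally show ?thesis by simp
qed

definition truncations_optimal :: "nat \<Rightarrow> complex mat \<Rightarrow> bool" where
  "truncations_optimal n M \<longleftrightarrow>
    (\<forall>m p X r Xr. m \<ge> 1 \<longrightarrow> p \<ge> 1 \<longrightarrow> X \<in> real_tensors m p n \<longrightarrow> valid_multirank n M r \<longrightarrow>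
        is_multirank_truncation m p n M r X Xr \<longrightarrow>
        (\<forall>Y \<in> real_tensors m p n.
           (\<forall>k<n. vec_space.rank m (transform m p M Y k) \<le> r k) \<longrightarrow>
           (frobenius_norm m p n (tensor_diff X Xr))\<^sup>2
             \<le> (frobenius_norm m p n (tensor_diff X Y))\<^sup>2))"

text \<open>The squared error is a sum over the slices of the image with positive weights \<open>1 / (d k)\<^sup>2\<close>, and
  each truncated slice minimises its own term among all matrices of the allowed rank.\<close>

theorem scaled_unitary_imp_truncations_optimal:
  assumes Q: "Q \<in> carrier_mat n n" "mat_adjoint Q * Q = 1\<^sub>m n"
    and d: "\<And>k. k < n \<Longrightarrow> d k \<noteq> 0"
    and M: "M = mat_diag n (\<lambda>i. complex_of_real (d i)) * Q"
  shows "truncations_optimal n M"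
  unfolding truncations_optimal_def
proof (intro allI impI ballI)
  fix m p X r Xr Y
  assume X: "X \<in> real_tensors m p n" and Xr: "is_multirank_truncation m p n M r X Xr"
    and Y: "Y \<in> real_tensors m p n"
    and rank: "\<forall>k<n. vec_space.rank m (transform m p M Y k) \<le> r k"
  have dimM: "dim_col M = n" using Q by (simp add: M)
  note norm = frobenius_norm_transform[OF Q d M]
  have c: "X \<in> complex_tensors m p n" "Xr \<in> complex_tensors m p n" "Y \<in> complex_tensors m p n"
    using X Xr Y by (auto simp: real_tensors_def is_multirank_truncation_def)
  have "frob_sq (transform m p M X k - transform m p M Xr k)
      \<le> frob_sq (transform m p M X k - transform m p M Y k)" if "k < n" for k
    using Xr rank that
    by (intro eckart_young[of _ m p "r k"]) (auto simp: is_multirank_truncation_def)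
  then show "(frobenius_norm m p n (tensor_diff X Xr))\<^sup>2
      \<le> (frobenius_norm m p n (tensor_diff X Y))\<^sup>2"
    using c by (auto simp: norm transform_tensor_diff[OF _ _ dimM] intro!: sum_mono divide_right_mono)
qed

section \<open>Diagonal tensors made of two tubes\<close>

definition diag2 :: "complex \<Rightarrow> complex \<Rightarrow> complex mat" where
  "diag2 a b = mat 2 2 (\<lambda>(i, j). if i = j then if i = 0 then a else b else 0)"

lemma diag2_carrier [simp]: "diag2 a b \<in> carrier_mat 2 2"
  by (simp add: diag2_def)

lemma diag2_times: "diag2 a b * diag2 c d = diag2 (a * c) (b * d)"
  by (rule eq_matI) (auto simp: diag2_def scalar_prod_def numeral_2_eq_2 less_Suc_eq)

lemma diag2_adjoint: "mat_adjoint (diag2 a b) = diag2 (cnj a) (cnj b)"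
  by (rule eq_matI) (auto simp: diag2_def mat_adjoint_eq)

lemma one_mat_2: "1\<^sub>m 2 = diag2 1 1"
  by (rule eq_matI) (auto simp: diag2_def)

lemma rect_diag_2: "rect_diag 2 2 s = diag2 (s 0) (s 1)"
  by (rule eq_matI) (auto simp: diag2_def rect_diag_def numeral_2_eq_2 less_Suc_eq)

text \<open>An SVD is explicit here: the phases of \<open>a\<close> and \<open>b\<close> form the left unitary factor and the right
  one is the identity. If \<open>\<bar>a\<bar> = \<bar>b\<bar>\<close>, the truncation to rank \<open>1\<close> that keeps \<open>a\<close> is one
  of several, and it competes with the matrix that keeps \<open>b\<close>.\<close>

lemma is_truncation_diag2:
  assumes "cmod b \<le> cmod a"
  shows "is_truncation 2 2 (diag2 a b) q (diag2 (if 0 < q then a else 0) (if 1 < q then b else 0))"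
proof -
  define u where "u z = (if z = 0 then 1 else z / cmod z)" for z
  have u: "u z * cmod z = z" "cnj (u z) * u z = 1" for z
    by (auto simp: u_def complex_norm_square[symmetric] power2_eq_square mult.commute[of "cnj z"])
  define s where "s = (\<lambda>i::nat. if i = 0 then cmod a else cmod b)"
  have "is_svd 2 2 (diag2 a b) (diag2 (u a) (u b)) s (diag2 1 1)"
    using assms
    by (auto simp: is_svd_def is_unitary_def diag2_adjoint diag2_times rect_diag_2 u one_mat_2 s_def)
  then show ?thesis
    unfolding is_truncation_def
    by (intro exI conjI, assumption) (auto simp: diag2_adjoint diag2_times rect_diag_2 u s_def)
qed

text \<open>The two conditions say that at most \<open>q\<close> of the numbers \<open>a\<close>, \<open>b\<close> are nonzero.\<close>

lemma rank_diag2: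
  assumes "q = 0 \<Longrightarrow> a = 0 \<and> b = 0" "q \<le> 1 \<Longrightarrow> a = 0 \<or> b = 0"
  shows "vec_space.rank 2 (diag2 a b) \<le> q"
proof -
  interpret vec_space "TYPE(complex)" 2 .
  consider "q = 0" | "q = 1" | "2 \<le> q" by linarith
  then show ?thesis
  proof cases
    case 1
    then have "diag2 a b = 0\<^sub>m 2 2" using assms by (intro eq_matI) (auto simp: diag2_def)
    then show ?thesis by (simp add: rank_0I)
  next
    case 2
    \<comment> \<open>The condition \<open>i = 0 \<longleftrightarrow> a \<noteq> 0\<close> selects the only diagonal position that can be nonzero.\<close>
    have "rank (diag2 a b) \<le> 1"
      using assms(2) 2
      by (intro rank_le_1_product_entries[OF diag2_carrier,
            where f = "\<lambda>i. (if i = 0 then a else b) * (if i = 0 \<longleftrightarrow> a \<noteq> 0 then 1 else 0)"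
            and g = "\<lambda>j. if j = 0 \<longleftrightarrow> a \<noteq> 0 then 1 else 0"])
        (auto simp: diag2_def)
    then show ?thesis using 2 by simp
  next
    case 3
    then show ?thesis using rank_le_nc[OF diag2_carrier, of a b] by simp
  qed
qed

definition tube_hat :: "complex mat \<Rightarrow> (nat \<Rightarrow> complex) \<Rightarrow> nat \<Rightarrow> complex" where
  "tube_hat M x k = (\<Sum>l<dim_col M. M $$ (k, l) * x l)"

lemma transform_diag2:
  "transform 2 2 M (\<lambda>l. diag2 (x l) (y l)) k = diag2 (tube_hat M x k) (tube_hat M y k)"
  by (rule eq_matI) (auto simp: transform_def diag2_def tube_hat_def numeral_2_eq_2 less_Suc_eq)

lemma frobenius_norm_diff_diag2:
  "(frobenius_norm 2 2 n (tensor_diff (\<lambda>l. diag2 (x l) (y l)) (\<lambda>l. diag2 (u l) (v l))))\<^sup>2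
    = (\<Sum>l<n. (cmod (x l - u l))\<^sup>2 + (cmod (y l - v l))\<^sup>2)"
  unfolding frobenius_norm_sq by (simp add: tensor_diff_def diag2_def numeral_2_eq_2)

text \<open>The only instances of optimality that the converse needs: tensors of size \<open>2 \<times> 2 \<times> n\<close> with a tube
  \<open>x\<close> at position \<open>(0, 0)\<close> and a tube \<open>y\<close> at position \<open>(1, 1)\<close>. Truncation and competitor are
  tensors of the same kind, so the rank condition counts nonzero entries and the inequality is one
  between vectors.\<close>

lemma truncations_optimal_diag2:
  assumes opt: "truncations_optimal n M" and r: "valid_multirank n M r"
    and real: "\<And>l. l < n \<Longrightarrow> x l \<in> \<real>" "\<And>l. l < n \<Longrightarrow> y l \<in> \<real>"
      "\<And>l. l < n \<Longrightarrow> u l \<in> \<real>" "\<And>l. l < n \<Longrightarrow> v l \<in> \<real>"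
    and le: "\<And>k. k < n \<Longrightarrow> cmod (tube_hat M y k) \<le> cmod (tube_hat M x k)"
    and x': "\<And>k. k < n \<Longrightarrow> tube_hat M x' k = (if 0 < r k then tube_hat M x k else 0)"
    and y': "\<And>k. k < n \<Longrightarrow> tube_hat M y' k = (if 1 < r k then tube_hat M y k else 0)"
    and uv: "\<And>k. k < n \<Longrightarrow> r k = 0 \<Longrightarrow> tube_hat M u k = 0 \<and> tube_hat M v k = 0"
      "\<And>k. k < n \<Longrightarrow> r k \<le> 1 \<Longrightarrow> tube_hat M u k = 0 \<or> tube_hat M v k = 0"
  shows "(\<Sum>l<n. (cmod (x l - x' l))\<^sup>2 + (cmod (y l - y' l))\<^sup>2)
    \<le> (\<Sum>l<n. (cmod (x l - u l))\<^sup>2 + (cmod (y l - v l))\<^sup>2)"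
proof -
  let ?T = "\<lambda>x y l. diag2 (x l) (y l)"
  have real_T: "?T x y \<in> real_tensors 2 2 n"
    if "\<And>l. l < n \<Longrightarrow> x l \<in> \<real>" "\<And>l. l < n \<Longrightarrow> y l \<in> \<real>" for x y
    using that by (auto simp: real_tensors_def complex_tensors_def) (auto simp: diag2_def)
  have "is_multirank_truncation 2 2 n M r (?T x y) (?T x' y')"
    using le x' y' is_truncation_diag2
    by (auto simp: is_multirank_truncation_def complex_tensors_def transform_diag2)
  moreover have "vec_space.rank 2 (transform 2 2 M (?T u v) k) \<le> r k" if "k < n" for k
    unfolding transform_diag2 using uv[OF that] by (intro rank_diag2) auto
  ultimately show ?thesis
    using opt[unfolded truncations_optimal_def, rule_format, of 2 2 "?T x y" r "?T x' y'" "?T u v"]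
      r real_T[OF real(1,2)] real_T[OF real(3,4)]
    by (simp add: frobenius_norm_diff_diag2)
qed

section \<open>Optimality forces orthogonal columns of the inverse\<close>

text \<open>First-order optimality: for small \<open>t\<close> of the sign of \<open>p\<close> the linear term would dominate.\<close>

lemma linear_le_quadratic_imp_zero:
  fixes p c :: real
  assumes "0 \<le> c" and le: "\<And>t. 2 * t * p \<le> t\<^sup>2 * c"
  shows "p = 0"
proof (rule ccontr)
  assume "p \<noteq> 0"
  \<comment> \<open>The minimiser would be \<open>p / c\<close>; the denominator \<open>c + 1\<close> also covers \<open>c = 0\<close>.\<close>
  define t where "t = p / (c + 1)"
  have p: "p = t * (c + 1)" using \<open>0 \<le> c\<close> by (simp add: t_def)
  have "t\<^sup>2 * (c + 2) \<le> 0"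
    using le[of t] unfolding p by (simp add: algebra_simps power2_eq_square)
  moreover have "0 < t\<^sup>2 * (c + 2)" using \<open>p \<noteq> 0\<close> \<open>0 \<le> c\<close> p by auto
  ultimately show False by simp
qed

locale conj_paired_rows =
  fixes n :: nat and M N :: "complex mat"
  assumes M: "M \<in> carrier_mat n n" and N: "N \<in> carrier_mat n n" and MN: "M * N = 1\<^sub>m n"
    and rows: "row_condition n M"
begin

text \<open>Twice the real part of \<open>a\<close> times the \<open>k\<close>-th column of the inverse of \<open>M\<close>. Its image is
  \<open>a\<close> at \<open>k\<close> plus the conjugate of \<open>a\<close> at the index of the conjugate row, so that these real
  tubes are supported, in the transform domain, on a single orbit of the conjugation of rows.\<close>

definition real_tube :: "complex \<Rightarrow> nat \<Rightarrow> nat \<Rightarrow> complex" where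
  "real_tube a k l = complex_of_real (2 * Re (a * N $$ (l, k)))"

text \<open>Comparing rows instead of indices makes this indicator of the orbit of \<open>k\<close> a valid multirank
  without reference to the index of the conjugate row.\<close>

definition orbit_rank :: "nat \<Rightarrow> nat \<Rightarrow> nat" where
  "orbit_rank k j = (if row M j = row M k \<or> row M j = conjugate (row M k) then 1 else 0)"

lemma sum_MN: "j < n \<Longrightarrow> k < n \<Longrightarrow> (\<Sum>l<n. M $$ (j, l) * N $$ (l, k)) = (if j = k then 1 else 0)"
  using times_index[OF M N, of j k] MN by simp

lemma row_inj: "j < n \<Longrightarrow> k < n \<Longrightarrow> row M j = row M k \<Longrightarrow> j = k"
proof -
  assume jk: "j < n" "k < n" "row M j = row M k"
  then have "M $$ (j, l) = M $$ (k, l)" if "l < n" for l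
    using that M by (metis carrier_matD index_row(1))
  then have "(\<Sum>l<n. M $$ (j, l) * N $$ (l, k)) = (\<Sum>l<n. M $$ (k, l) * N $$ (l, k))" by simp
  then show "j = k" using sum_MN[of j k] sum_MN[of k k] jk by (auto split: if_splits)
qed

lemma row_conj_index:
  "j < n \<Longrightarrow> row M i = conjugate (row M j) \<Longrightarrow> i < n \<Longrightarrow> l < n
    \<Longrightarrow> M $$ (i, l) = cnj (M $$ (j, l))"
  using M by (metis carrier_matD conjugate_complex_def dim_vec_conjugate index_row(1) index_row(2)
      vec_index_conjugate)

lemma conj_row_exists:
  assumes "j < n"
  obtains j' where "j' < n" "row M j' = conjugate (row M j)"
proof (cases "\<forall>l<n. M $$ (j, l) \<in> \<real>")
  case True
  then have "row M j = conjugate (row M j)"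
    using M assms by (intro eq_vecI) (auto simp: complex_is_Real_iff complex_eq_iff)
  then show ?thesis using that[of j] assms by simp
next
  case False
  then obtain j' where "j' < n" "row M j = conjugate (row M j')"
    using rows assms unfolding row_condition_def by metis
  then show ?thesis using that[of j'] by simp
qed

text \<open>By the row condition, the conjugate of row \<open>j\<close> is itself a row \<open>j'\<close> of \<open>M\<close>, and conjugating the
  sum turns it into an entry of \<open>M N = 1\<close> in row \<open>j'\<close>.\<close>

lemma sum_M_cnj_N:
  assumes "j < n" "k < n"
  shows "(\<Sum>l<n. M $$ (j, l) * cnj (N $$ (l, k)))
    = (if row M k = conjugate (row M j) then 1 else 0)"
proof -
  obtain j' where j': "j' < n" "row M j' = conjugate (row M j)" using conj_row_exists[OF assms(1)] .
  have "(\<Sum>l<n. M $$ (j, l) * cnj (N $$ (l, k))) = cnj (\<Sum>l<n. M $$ (j', l) * N $$ (l, k))"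
    using row_conj_index[OF assms(1) j'(2,1)] by simp
  also have "\<dots> = (if j' = k then 1 else 0)" using sum_MN[OF j'(1) assms(2)] by simp
  also have "j' = k \<longleftrightarrow> row M k = conjugate (row M j)" using j' row_inj[OF j'(1) assms(2)] by auto
  finally show ?thesis .
qed

lemma tube_hat_real_tube:
  assumes "j < n" "k < n"
  shows "tube_hat M (real_tube a k) j
    = (if j = k then a else 0) + (if row M k = conjugate (row M j) then cnj a else 0)"
proof -
  have *: "complex_of_real (2 * Re z) = z + cnj z" for z by (simp add: complex_eq_iff)
  have "tube_hat M (real_tube a k) j
      = a * (\<Sum>l<n. M $$ (j, l) * N $$ (l, k)) + cnj a * (\<Sum>l<n. M $$ (j, l) * cnj (N $$ (l, k)))"
    using M unfolding tube_hat_def real_tube_def *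
    by (simp add: algebra_simps sum.distrib sum_distrib_left)
  then show ?thesis using assms by (simp add: sum_MN sum_M_cnj_N)
qed

lemma norm_real_tube_sq: "(cmod (real_tube a k l))\<^sup>2 = 4 * (Re (a * N $$ (l, k)))\<^sup>2"
  unfolding real_tube_def norm_of_real power2_abs power_mult_distrib by simp

lemma orbit_rank_valid: "valid_multirank n M (orbit_rank k)"
  unfolding valid_multirank_def orbit_rank_def by (metis conjugate_id)

lemma orbit_rank_not_gt_1 [simp]: "\<not> Suc 0 < orbit_rank k j"
  by (simp add: orbit_rank_def)

lemma real_tube_real [simp]: "real_tube a k l \<in> \<real>"
  by (simp add: real_tube_def)

lemma tube_hat_off_orbit:
  assumes "j < n" "k < n" "orbit_rank k j = 0"
  shows "tube_hat M (real_tube a k) j = 0"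
  using assms by (auto simp: tube_hat_real_tube orbit_rank_def split: if_splits)

lemma tube_hat_zero [simp]: "tube_hat M (\<lambda>_. 0) j = 0"
  by (simp add: tube_hat_def)

text \<open>A tube supported on the orbit of \<open>k\<close> is truncated to zero by the multirank that lives on the orbit
  of \<open>l\<close>. All multiples of a tube supported on the orbit of \<open>l\<close> are admissible competitors, so
  zero is the best approximation on that line, and the two tubes are orthogonal. Real and
  imaginary parts of the columns are such tubes.\<close>

lemma columns_orthogonal_distinct_orbits:
  assumes opt: "truncations_optimal n M" and kl: "k < n" "l < n" "k \<noteq> l"
    and ne: "row M k \<noteq> conjugate (row M l)"
  shows "(\<Sum>i<n. cnj (N $$ (i, k)) * N $$ (i, l)) = 0"
proof -
  have orth: "(\<Sum>i<n. Re (a * N $$ (i, k)) * Re (b * N $$ (i, l))) = 0" for a b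
  proof -
    define X where "X i = 2 * Re (a * N $$ (i, k))" for i
    define U where "U i = 2 * Re (b * N $$ (i, l))" for i
    have "2 * t * (\<Sum>i<n. X i * U i) \<le> t\<^sup>2 * (\<Sum>i<n. (U i)\<^sup>2)" for t
    proof -
      have on_orbit: "tube_hat M (real_tube a k) j = 0" if j: "j < n" "0 < orbit_rank l j" for j
      proof -
        have "row M j = row M l \<or> row M j = conjugate (row M l)"
          using j by (auto simp: orbit_rank_def split: if_splits)
        then have "j \<noteq> k" "row M k \<noteq> conjugate (row M j)"
          using row_inj[OF kl(1,2)] kl(3) ne by auto
        then show ?thesis using j kl by (simp add: tube_hat_real_tube)
      qed
      have diff: "real_tube a k i - real_tube (t * b) l i = complex_of_real (X i - t * U i)" for i
        by (simp add: real_tube_def X_def U_def mult.assoc)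
      have norm_X: "(cmod (real_tube a k i))\<^sup>2 = (X i)\<^sup>2" for i
        unfolding norm_real_tube_sq X_def power_mult_distrib by simp
      have "(\<Sum>i<n. (cmod (real_tube a k i - 0))\<^sup>2 + (cmod (0 - 0))\<^sup>2)
          \<le> (\<Sum>i<n. (cmod (real_tube a k i - real_tube (t * b) l i))\<^sup>2 + (cmod (0 - 0))\<^sup>2)"
        using tube_hat_off_orbit[OF _ kl(2)] on_orbit
        by (intro truncations_optimal_diag2[OF opt orbit_rank_valid[of l]]) auto
      then have "(\<Sum>i<n. (X i)\<^sup>2) \<le> (\<Sum>i<n. (X i - t * U i)\<^sup>2)"
        unfolding diff norm_of_real power2_abs
        by (simp add: norm_X)
      also have "\<dots> = (\<Sum>i<n. (X i)\<^sup>2) - 2 * t * (\<Sum>i<n. X i * U i) + t\<^sup>2 * (\<Sum>i<n. (U i)\<^sup>2)"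
        by (simp add: power2_diff sum.distrib sum_subtractf sum_distrib_left power_mult_distrib
            algebra_simps)
      finally show ?thesis by simp
    qed
    then have "(\<Sum>i<n. X i * U i) = 0"
      by (rule linear_le_quadratic_imp_zero[rotated]) (auto intro!: sum_nonneg)
    moreover have "(\<Sum>i<n. X i * U i) = 4 * (\<Sum>i<n. Re (a * N $$ (i, k)) * Re (b * N $$ (i, l)))"
      unfolding X_def U_def sum_distrib_left
      by (intro sum.cong refl) (simp del: times_complex.sel)
    ultimately show ?thesis by simp
  qed
  \<comment> \<open>Multiplication by \<open>- \<i>\<close> turns real parts into imaginary parts.\<close>
  show ?thesis
    using orth[of 1 1] orth[of 1 "- \<i>"] orth[of "- \<i>" 1] orth[of "- \<i>" "- \<i>"]
    by (simp add: complex_eq_iff sum.distrib sum_subtractf)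
qed

text \<open>Now \<open>N\<^sub>k\<close> is the conjugate of \<open>N\<^sub>l\<close>, and the inner product is \<open>h = \<Sum>\<^sub>i N\<^sub>i\<^sub>l\<^sup>2\<close>. Tubes with a
  single entry per slice cannot see it, because the two slices are truncated together; two diagonal
  entries with tied singular values can. With the tubes of \<open>a\<close> and \<open>\<i> a\<close> on the diagonal, the
  truncation may keep either one, hence keeping the first must not be worse than keeping the
  second. This reads \<open>Re (a\<^sup>2 h) \<ge> 0\<close>, and as \<open>a\<close> is arbitrary, \<open>h = 0\<close>.\<close>

lemma columns_orthogonal_conj_pair:
  assumes opt: "truncations_optimal n M" and kl: "k < n" "l < n" "k \<noteq> l"
    and conj: "row M k = conjugate (row M l)"
  shows "(\<Sum>i<n. cnj (N $$ (i, k)) * N $$ (i, l)) = 0"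
proof -
  \<comment> \<open>The conjugate of \<open>N\<^sub>k\<close> has the same image under \<open>M\<close> as \<open>N\<^sub>l\<close>, namely the \<open>l\<close>-th unit vector.\<close>
  have col_conj: "cnj (N $$ (i, k)) = N $$ (i, l)" if "i < n" for i
  proof -
    have NM: "N * M = 1\<^sub>m n" using mat_mult_left_right_inverse[OF M N MN] .
    define w where "w = mat n 1 (\<lambda>(i, _). cnj (N $$ (i, k)))"
    have w: "w \<in> carrier_mat n 1" "\<And>i. i < n \<Longrightarrow> w $$ (i, 0) = cnj (N $$ (i, k))"
      by (auto simp: w_def)
    have Mw: "(M * w) $$ (j, 0) = (if j = l then 1 else 0)" if "j < n" for j
    proof -
      have "(M * w) $$ (j, 0) = (\<Sum>i<n. M $$ (j, i) * cnj (N $$ (i, k)))"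
        using times_index[OF M w(1) that, of 0] w(2) by simp
      moreover have "row M k = conjugate (row M j) \<longleftrightarrow> j = l"
        using conj row_inj[OF that kl(2)] by auto
      ultimately show ?thesis using sum_M_cnj_N[OF that kl(1)] by simp
    qed
    have "N * (M * w) = w"
      using M N w NM by (subst assoc_mult_mat[symmetric, of _ n n _ n _ 1]) auto
    then have "w $$ (i, 0) = (\<Sum>j<n. N $$ (i, j) * (M * w) $$ (j, 0))"
      using times_index[OF N mult_carrier_mat[OF M w(1)] that, of 0] by simp
    also have "\<dots> = N $$ (i, l)"
      using kl(2) by (simp add: Mw if_distrib[of "(*) _"] sum.delta cong: if_cong del: index_mult_mat)
    finally show ?thesis using w(2)[OF that] by simp
  qed
  define h where "h = (\<Sum>i<n. (N $$ (i, l))\<^sup>2)"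
  have "0 \<le> Re (a\<^sup>2 * h)" for a
  proof -
    have hat: "tube_hat M (real_tube b l) j = (if j = l then b else 0) + (if j = k then cnj b else 0)"
      if "j < n" for b j
    proof -
      have "row M l = conjugate (row M j) \<longleftrightarrow> j = k"
        using row_inj[OF that kl(1)] conj by (metis conjugate_id)
      then show ?thesis using tube_hat_real_tube[OF that kl(2)] by simp
    qed
    have ineq: "(\<Sum>i<n. (cmod (real_tube a l i - real_tube a l i))\<^sup>2
            + (cmod (real_tube (\<i> * a) l i - 0))\<^sup>2)
        \<le> (\<Sum>i<n. (cmod (real_tube a l i - 0))\<^sup>2
            + (cmod (real_tube (\<i> * a) l i - real_tube (\<i> * a) l i))\<^sup>2)"
    proof (rule truncations_optimal_diag2[OF opt orbit_rank_valid[of l]])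
      fix j assume j: "j < n"
      show "cmod (tube_hat M (real_tube (\<i> * a) l) j) \<le> cmod (tube_hat M (real_tube a l) j)"
        using kl(3) by (auto simp: hat[OF j] norm_mult)
    qed (use tube_hat_off_orbit[OF _ kl(2)] in auto)
    have "(\<Sum>i<n. (Im (a * N $$ (i, l)))\<^sup>2) \<le> (\<Sum>i<n. (Re (a * N $$ (i, l)))\<^sup>2)"
    proof -
      have "Re (\<i> * a * z) = - Im (a * z)" for z by simp
      then show ?thesis
        using ineq
        by (simp add: norm_real_tube_sq mult.assoc del: times_complex.sel flip: sum_distrib_left)
    qed
    moreover have "Re (z\<^sup>2) = (Re z)\<^sup>2 - (Im z)\<^sup>2" for z
      by (simp add: power2_eq_square)
    then have "Re (a\<^sup>2 * h) = (\<Sum>i<n. (Re (a * N $$ (i, l)))\<^sup>2 - (Im (a * N $$ (i, l)))\<^sup>2)"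
      by (simp only: h_def sum_distrib_left Re_sum power_mult_distrib[symmetric])
    ultimately show ?thesis by (simp only: sum_subtractf diff_ge_0_iff_ge)
  qed
  \<comment> \<open>The squares are \<open>1\<close>, \<open>-1\<close>, \<open>2 \<i>\<close> and \<open>-2 \<i>\<close>.\<close>
  from this[of 1] this[of \<i>] this[of "1 + \<i>"] this[of "1 - \<i>"] have "h = 0"
    by (simp add: complex_eq_iff power2_eq_square algebra_simps)
  then show ?thesis using col_conj by (simp add: h_def power2_eq_square)
qed

text \<open>Normalising the pairwise orthogonal columns of \<open>N = M\<^sup>-\<^sup>1\<close> gives a unitary matrix \<open>P = N D\<close> with
  \<open>D\<close> diagonal and real, and then \<open>M = D P\<^sup>H\<close>.\<close>

theorem truncations_optimal_imp_scaled_unitary: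
  assumes opt: "truncations_optimal n M"
  shows "\<exists>(d :: nat \<Rightarrow> real) Q. (\<forall>i<n. d i \<noteq> 0)
    \<and> Q \<in> carrier_mat n n \<and> mat_adjoint Q * Q = 1\<^sub>m n
    \<and> M = mat_diag n (\<lambda>i. complex_of_real (d i)) * Q"
proof -
  define h where "h k = sqrt (\<Sum>i<n. (cmod (N $$ (i, k)))\<^sup>2)" for k
  have hh: "complex_of_real (h k) * h k = (\<Sum>i<n. cnj (N $$ (i, k)) * N $$ (i, k))" for k
  proof -
    have "complex_of_real (h k) * h k = complex_of_real (\<Sum>i<n. (cmod (N $$ (i, k)))\<^sup>2)"
      by (simp add: h_def sum_nonneg flip: of_real_mult)
    then show ?thesis by (simp only: of_real_sum complex_norm_square mult.commute)
  qed
  have h0: "h k \<noteq> 0" if k: "k < n" for k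
  proof
    assume "h k = 0"
    then have "\<forall>i<n. N $$ (i, k) = 0" by (simp add: h_def sum_nonneg_eq_0_iff)
    then show False using sum_MN[OF k k] by simp
  qed
  define P where "P = mat n n (\<lambda>(i, k). N $$ (i, k) / h k)"
  define Q where "Q = mat_adjoint P"
  have P: "P \<in> carrier_mat n n" and Q: "Q \<in> carrier_mat n n" by (auto simp: P_def Q_def)
  have P_index: "P $$ (i, k) = N $$ (i, k) / h k" if "i < n" "k < n" for i k
    using that by (simp add: P_def)
  have QP: "Q * P = 1\<^sub>m n"
  proof (rule eq_matI)
    fix k l assume "k < dim_row (1\<^sub>m n :: complex mat)" "l < dim_col (1\<^sub>m n :: complex mat)"
    then have kl: "k < n" "l < n" by auto
    have "(Q * P) $$ (k, l) = (\<Sum>i<n. cnj (N $$ (i, k)) * N $$ (i, l)) / (h k * h l)"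
      unfolding times_index[OF Q P kl] using kl
      by (simp add: Q_def mat_adjoint_index[OF P] P_index sum_divide_distrib)
    also have "\<dots> = 1\<^sub>m n $$ (k, l)"
    proof (cases "k = l")
      case True
      then show ?thesis using kl h0 by (simp flip: hh)
    next
      case False
      then show ?thesis
        using kl columns_orthogonal_conj_pair[OF opt kl] columns_orthogonal_distinct_orbits[OF opt kl]
        by (cases "row M k = conjugate (row M l)") auto
    qed
    finally show "(Q * P) $$ (k, l) = 1\<^sub>m n $$ (k, l)" .
  qed (use P Q in auto)
  have NM: "N * M = 1\<^sub>m n" using mat_mult_left_right_inverse[OF M N MN] .
  let ?D = "mat_diag n (\<lambda>i. complex_of_real (1 / h i))"
  have "P = N * ?D"
    by (rule eq_matI) (auto simp: P_def mat_diag_mult_right[OF N])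
  have QN: "Q * N \<in> carrier_mat n n" and DQ: "?D * Q \<in> carrier_mat n n"
    using Q N by (auto intro: mult_carrier_mat[OF _ Q])
  have "Q * N * ?D = 1\<^sub>m n"
    using QP unfolding \<open>P = N * ?D\<close> assoc_mult_mat[OF Q N mat_diag_dim] .
  from mat_mult_left_right_inverse[OF QN mat_diag_dim this]
  have DQN: "?D * Q * N = 1\<^sub>m n"
    unfolding assoc_mult_mat[OF mat_diag_dim Q N] .
  have "?D * Q * N * M = M"
    unfolding DQN using M by simp
  moreover have "?D * Q * N * M = ?D * Q"
    unfolding assoc_mult_mat[OF DQ N M] NM using DQ by (rule right_mult_one_mat)
  ultimately have "M = ?D * Q" by simp
  moreover have "mat_adjoint Q * Q = 1\<^sub>m n"
    using mat_mult_left_right_inverse[OF Q P QP] by (simp add: Q_def)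
  ultimately show ?thesis using Q h0 by (intro exI[of _ "\<lambda>i. 1 / h i"] exI[of _ Q]) auto
qed

end

section \<open>The equivalence\<close>

theorem theorem3p3:
  fixes n :: nat and M :: "complex mat"
  assumes "n \<ge> 1"
    and "M \<in> carrier_mat n n"
    and "invertible_mat M"
    and "row_condition n M"
  shows
    "(\<forall>m p X r Xr. m \<ge> 1 \<longrightarrow> p \<ge> 1 \<longrightarrow> X \<in> real_tensors m p n \<longrightarrow> valid_multirank n M r \<longrightarrow>
        is_multirank_truncation m p n M r X Xr \<longrightarrow>
        (\<forall>Y \<in> real_tensors m p n.
           (\<forall>k<n. vec_space.rank m (transform m p M Y k) \<le> r k) \<longrightarrow>
           (frobenius_norm m p n (tensor_diff X Xr))\<^sup>2
             \<le> (frobenius_norm m p n (tensor_diff X Y))\<^sup>2))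
     \<longleftrightarrow>
     (\<exists>(d :: nat \<Rightarrow> real) Q. (\<forall>i<n. d i \<noteq> 0)
        \<and> Q \<in> carrier_mat n n \<and> mat_adjoint Q * Q = 1\<^sub>m n
        \<and> M = mat_diag n (\<lambda>i. complex_of_real (d i)) * Q)"
  unfolding truncations_optimal_def[symmetric]
proof
  assume opt: "truncations_optimal n M"
  obtain N where "inverts_mat M N" "inverts_mat N M"
    using assms(3) by (auto simp: invertible_mat_def)
  then have MN: "M * N = 1\<^sub>m n" and NM: "N * M = 1\<^sub>m (dim_row N)"
    using assms(2) by (auto simp: inverts_mat_def)
  have "N \<in> carrier_mat n n"
    using arg_cong[OF MN, of dim_col] arg_cong[OF NM, of dim_col] assms(2) by (intro carrier_matI) auto
  then interpret conj_paired_rows n M N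
    using assms MN by unfold_locales
  show "\<exists>(d :: nat \<Rightarrow> real) Q. (\<forall>i<n. d i \<noteq> 0)
        \<and> Q \<in> carrier_mat n n \<and> mat_adjoint Q * Q = 1\<^sub>m n
        \<and> M = mat_diag n (\<lambda>i. complex_of_real (d i)) * Q"
    using opt by (rule truncations_optimal_imp_scaled_unitary)
next
  assume "\<exists>(d :: nat \<Rightarrow> real) Q. (\<forall>i<n. d i \<noteq> 0)
        \<and> Q \<in> carrier_mat n n \<and> mat_adjoint Q * Q = 1\<^sub>m n
        \<and> M = mat_diag n (\<lambda>i. complex_of_real (d i)) * Q"
  then show "truncations_optimal n M"
    using scaled_unitary_imp_truncations_optimal by metis
qed

end
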